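(* Let $A,C>0$, let $U$ be an axially symmetric potential as in the context, and consider a relative equilibrium with data $(\mathbf R_0,\mathbf P_0,\mathbf G_0,N)$ such that $\frac{\partial U}{\partial \mathbf R}(\mathbf R_0)\neq \mathbf 0$. Write $\mathbf R_0=[R_1,R_2,R_3]^T$, $\mathbf P_0=[P_1,P_2,P_3]^T$, $\boldsymbol\Omega_0=\mathbf I^{-1}\mathbf G_0=[\Omega_1,\Omega_2,\Omega_3]^T$ and $\widetilde{\boldsymbol\Omega}=\boldsymbol\Omega_0+[0,0,N]^T=[\Omega_1,\Omega_2,\widetilde\Omega_3]^T$. Then: (i) the relative equilibrium is locally central, i.e. $\mathbf R_0\times\frac{\partial U}{\partial \mathbf R}(\mathbf R_0)=\mathbf 0$, if and only if $\langle\widetilde{\boldsymbol\Omega},\mathbf R_0\rangle=0$; (ii) if it is locally central, then either $\Omega_1=\Omega_2=0$ (cylindrical precession) or $A\widetilde\Omega_3=C\Omega_3$ (inclined co-planar precession); (iii) if it is not locally central (conic precession), then $P_3=R_2\Omega_1-R_1\Omega_2=0$.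
   Context: Let $A,C>0$ and $\mathbf I=\operatorname{diag}(A,A,C)$. Let $D\subset\mathbb R^3\setminus\{\mathbf 0\}$ be an open set invariant under all rotations about the third coordinate axis, and let $U:D\to\mathbb R$ be a smooth function satisfying the axial symmetry condition $R_1\frac{\partial U}{\partial R_2}-R_2\frac{\partial U}{\partial R_1}=0$ on $D$. The (body-frame) equations of motion of a point mass and an axially symmetric rigid body are $$\dot{\mathbf R}=\mathbf R\times\boldsymbol\Omega+\mathbf P,\quad \dot{\mathbf P}=\mathbf P\times\boldsymbol\Omega-\frac{\partial U}{\partial\mathbf R},\quad \dot{\mathbf G}=\mathbf G\times\boldsymbol\Omega+\mathbf R\times\frac{\partial U}{\partial\mathbf R},\qquad \boldsymbol\Omega=\mathbf I^{-1}\mathbf G,$$ for $(\mathbf R,\mathbf P,\mathbf G)\in D\times\mathbb R^3\times\mathbb R^3$. Let $\mathbf A_3(\varphi)$ denote the matrix of rotation by angle $\varphi$ about the third axis, $\mathbf A_3(\varphi)=\begin{bmatrix}\cos\varphi&-\sin\varphi&0\\ \sin\varphi&\cos\varphi&0\\0&0&1\end{bmatrix}$. A relative equilibrium with data $(\mathbf R_0,\mathbf P_0,\mathbf G_0,N)$, where $\mathbf R_0\in D$, $\mathbf P_0,\mathbf G_0\in\mathbb R^3$ are constant vectors and $N\in\mathbb R$, is a solution of these equations of the form $\mathbf R(t)=\mathbf A_3(Nt)\mathbf R_0$, $\mathbf P(t)=\mathbf A_3(Nt)\mathbf P_0$, $\mathbf G(t)=\mathbf A_3(Nt)\mathbf G_0$.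 It is called locally central if $\frac{\partial U}{\partial\mathbf R}(\mathbf R_0)$ is parallel to $\mathbf R_0$. *)

theory Defs
  imports "HOL-Analysis.Analysis"
begin

fun Ck_on :: "nat \<Rightarrow> ('a::real_normed_vector \<Rightarrow> 'b::real_normed_vector) \<Rightarrow> 'a set \<Rightarrow> bool" where
  "Ck_on 0 f S \<longleftrightarrow> continuous_on S f"
| "Ck_on (Suc k) f S \<longleftrightarrow>
     (\<forall>x\<in>S. f differentiable (at x)) \<and>
     (\<forall>v. Ck_on k (\<lambda>x. frechet_derivative f (at x) v) S)"

(* Meaningful for open S only: derivatives are taken in the full space, not within S. *)
definition smooth_on_open :: "('a::real_normed_vector \<Rightarrow> 'b::real_normed_vector) \<Rightarrow> 'a set \<Rightarrow> bool" where
  "smooth_on_open f S \<longleftrightarrow> (\<forall>k. Ck_on k f S)"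

(* The vector of partial derivatives; only meaningful at points where f is differentiable. *)
definition grad :: "(real^3 \<Rightarrow> real) \<Rightarrow> real^3 \<Rightarrow> real^3" where
  "grad f x = (\<chi> i. frechet_derivative f (at x) (axis i 1))"

definition A3 :: "real \<Rightarrow> real^3^3" where
  "A3 \<phi> = vector [vector [cos \<phi>, - sin \<phi>, 0],
                   vector [sin \<phi>, cos \<phi>, 0],
                   vector [0, 0, 1]]"

definition inertia :: "real \<Rightarrow> real \<Rightarrow> real^3^3" where
  "inertia A C = vector [vector [A, 0, 0],
                         vector [0, A, 0],
                         vector [0, 0, C]]"

definition angular_velocity :: "real \<Rightarrow> real \<Rightarrow> real^3 \<Rightarrow> real^3" where
  "angular_velocity A C G = matrix_inv (inertia A C) *v G"

(* U is a total function in HOL; only its values on the open set D matter. *)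
definition axially_symmetric_potential :: "(real^3) set \<Rightarrow> (real^3 \<Rightarrow> real) \<Rightarrow> bool" where
  "axially_symmetric_potential D U \<longleftrightarrow>
     open D \<and> 0 \<notin> D \<and> (\<forall>\<phi>. \<forall>R\<in>D. A3 \<phi> *v R \<in> D) \<and>
     smooth_on_open U D \<and>
     (\<forall>R\<in>D. R$1 * grad U R $ 2 - R$2 * grad U R $ 1 = 0)"

definition is_motion ::
  "real \<Rightarrow> real \<Rightarrow> (real^3) set \<Rightarrow> (real^3 \<Rightarrow> real) \<Rightarrow>
   (real \<Rightarrow> real^3) \<Rightarrow> (real \<Rightarrow> real^3) \<Rightarrow> (real \<Rightarrow> real^3) \<Rightarrow> bool" where
  "is_motion A C D U R P G \<longleftrightarrow>
     (\<forall>t. let \<Omega> = angular_velocity A C (G t) in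
        R t \<in> D \<and>
        (R has_vector_derivative cross3 (R t) \<Omega> + P t) (at t) \<and>
        (P has_vector_derivative cross3 (P t) \<Omega> - grad U (R t)) (at t) \<and>
        (G has_vector_derivative cross3 (G t) \<Omega> + cross3 (R t) (grad U (R t))) (at t))"

definition relative_equilibrium ::
  "real \<Rightarrow> real \<Rightarrow> (real^3) set \<Rightarrow> (real^3 \<Rightarrow> real) \<Rightarrow>
   real^3 \<Rightarrow> real^3 \<Rightarrow> real^3 \<Rightarrow> real \<Rightarrow> bool" where
  "relative_equilibrium A C D U R0 P0 G0 N \<longleftrightarrow>
     R0 \<in> D \<and>
     is_motion A C D U (\<lambda>t. A3 (N * t) *v R0) (\<lambda>t. A3 (N * t) *v P0) (\<lambda>t. A3 (N * t) *v G0)"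

(* Collinearity with 0 is the library's form of "the two vectors are parallel". *)
definition locally_central :: "(real^3 \<Rightarrow> real) \<Rightarrow> real^3 \<Rightarrow> bool" where
  "locally_central U R0 \<longleftrightarrow> collinear {0, R0, grad U R0}"

end

(* Evaluated at t = 0, and with w denoting the angular velocity shifted by N e3, the equations of
   motion read P0 = w x R0, grad U = P0 x w and G0 x w + R0 x grad U = 0.  By the triple product
   expansion grad U = |w|^2 R0 - (w . R0) w, so R0 x grad U = (w . R0) P0, and P0 is nonzero because
   grad U = P0 x w is; this is (i).  In the locally central case G0 x w = 0, whose first two
   components give (ii).  Otherwise the third component of R0 x grad U, which vanishes by axial
   symmetry, is a nonzero multiple of the third component of P0; this is (iii). *)

theory Submission
  imports Defs
begin

text \<open>Isolates the dependence on the angle in the scalar factors \<open>cos\<close> and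
  \<open>sin\<close> of constant vectors, so that the rotation can be differentiated by the scalar
  rules.\<close>

lemma A3_mult_vec:
  "A3 \<phi> *v x = cos \<phi> *\<^sub>R vector [x$1, x$2, 0] + sin \<phi> *\<^sub>R vector [- x$2, x$1, 0] + vector [0, 0, x$3]"
  by (simp add: A3_def vec_eq_iff forall_3 matrix_vector_mult_def sum_3)

lemma A3_0: "A3 0 *v x = x"
  by (simp add: A3_mult_vec vec_eq_iff forall_3)

lemma has_vector_derivative_A3_rotation_0:
  "((\<lambda>t. A3 (N * t) *v x) has_vector_derivative cross3 (vector [0, 0, N]) x) (at 0)"
proof -
  have "((\<lambda>t. A3 (N * t) *v x) has_vector_derivative N *\<^sub>R vector [- x$2, x$1, 0]) (at 0)"
    unfolding A3_mult_vec by (auto intro!: derivative_eq_intros)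
  also have "N *\<^sub>R vector [- x$2, x$1, 0] = cross3 (vector [0, 0, N]) x"
    by (simp add: cross3_simps)
  finally show ?thesis .
qed

text \<open>\<open>matrix_inv\<close> is a choice operator, so it cancels only once an inverse is
  known to exist; here the determinant A^2 C is nonzero. This allows G to be expressed through the
  components of the angular velocity.\<close>

lemma inertia_mult_angular_velocity:
  assumes "A \<noteq> 0" "C \<noteq> 0"
  shows "inertia A C *v angular_velocity A C G = G"
proof -
  have "det (inertia A C) \<noteq> 0"
    using assms by (simp add: inertia_def det_3)
  then obtain B where "inertia A C ** B = mat 1" "B ** inertia A C = mat 1"
    unfolding invertible_det_nz[symmetric] invertible_def by blast
  then have "inertia A C ** matrix_inv (inertia A C) = mat 1"
    unfolding matrix_inv_def by (metis (mono_tags, lifting) someI_ex)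
  then show ?thesis
    by (simp add: angular_velocity_def matrix_vector_mul_assoc)
qed

lemma inertia_mult_vec: "inertia A C *v w = vector [A * w$1, A * w$2, C * w$3]"
  by (simp add: inertia_def vec_eq_iff forall_3 matrix_vector_mult_def sum_3)

lemma locally_central_iff_cross3: "locally_central U R \<longleftrightarrow> cross3 R (grad U R) = 0"
  by (simp add: locally_central_def cross_eq_0)

lemma relative_equilibrium_equations:
  assumes "relative_equilibrium A C D U R P G N"
  defines "w \<equiv> angular_velocity A C G + vector [0, 0, N]"
  shows "P = cross3 w R"
    and "grad U R = cross3 P w"
    and "cross3 G w + cross3 R (grad U R) = 0"
proof -
  let ?\<Omega> = "angular_velocity A C G" and ?n = "vector [0, 0, N] :: real^3"
  have "((\<lambda>t. A3 (N * t) *v R) has_vector_derivative cross3 R ?\<Omega> + P) (at 0)"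
    and "((\<lambda>t. A3 (N * t) *v P) has_vector_derivative cross3 P ?\<Omega> - grad U R) (at 0)"
    and "((\<lambda>t. A3 (N * t) *v G) has_vector_derivative cross3 G ?\<Omega> + cross3 R (grad U R)) (at 0)"
    using assms(1) unfolding relative_equilibrium_def is_motion_def Let_def
    by (metis (no_types, lifting) A3_0 mult_zero_right)+
  \<comment> \<open>A derivative is unique, so at t = 0 the velocity of the uniform rotation equals
    the one prescribed by the equations of motion.\<close>
  then have *: "cross3 ?n R = cross3 R ?\<Omega> + P"
    "cross3 ?n P = cross3 P ?\<Omega> - grad U R"
    "cross3 ?n G = cross3 G ?\<Omega> + cross3 R (grad U R)"
    by (auto intro: vector_derivative_unique_at has_vector_derivative_A3_rotation_0)
  \<comment> \<open>The rotation term moves to the other side with its factors swapped, which turns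
    it into the contribution of N to \<open>w\<close>.\<close>
  have shift: "cross3 x w = cross3 x ?\<Omega> - cross3 ?n x" for x
    by (simp add: w_def cross_add_right cross_skew[of x ?n])
  show "P = cross3 w R"
    using *(1) shift[of R] by (simp add: cross_skew[of w R])
  show "grad U R = cross3 P w" "cross3 G w + cross3 R (grad U R) = 0"
    using *(2,3) by (simp_all add: shift)
qed

lemma cross3_cross_triple: "cross3 x (cross3 (cross3 w x) w) = (w \<bullet> x) *\<^sub>R cross3 w x"
  by (simp add: cross3_def inner_vec_def sum_3 vec_eq_iff forall_3 algebra_simps)

theorem mainTheorem1:
  fixes A C N :: real
    and D :: "(real^3) set" and U :: "real^3 \<Rightarrow> real"
    and R0 P0 G0 \<Omega>0 \<Omega>t :: "real^3"
  assumes "A > 0" and "C > 0"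
    and "axially_symmetric_potential D U"
    and "relative_equilibrium A C D U R0 P0 G0 N"
    and "grad U R0 \<noteq> 0"
    and "\<Omega>0 = angular_velocity A C G0"
    and "\<Omega>t = \<Omega>0 + vector [0, 0, N]"
  shows "((locally_central U R0 \<longleftrightarrow> cross3 R0 (grad U R0) = 0) \<and>
          (locally_central U R0 \<longleftrightarrow> \<Omega>t \<bullet> R0 = 0)) \<and>
         (locally_central U R0 \<longrightarrow>
            (\<Omega>0$1 = 0 \<and> \<Omega>0$2 = 0) \<or> A * \<Omega>t$3 = C * \<Omega>0$3) \<and>
         (\<not> locally_central U R0 \<longrightarrow>
            P0$3 = R0$2 * \<Omega>0$1 - R0$1 * \<Omega>0$2 \<and>
            R0$2 * \<Omega>0$1 - R0$1 * \<Omega>0$2 = 0)"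
proof -
  note eqs = relative_equilibrium_equations[OF assms(4), folded assms(6), folded assms(7)]
  have torque: "cross3 R0 (grad U R0) = (\<Omega>t \<bullet> R0) *\<^sub>R P0"
    unfolding eqs(2) unfolding eqs(1) by (rule cross3_cross_triple)
  have "P0 \<noteq> 0"
    using assms(5) eqs(2) by auto
  with torque have central_iff: "locally_central U R0 \<longleftrightarrow> \<Omega>t \<bullet> R0 = 0"
    by (simp add: locally_central_iff_cross3)
  have \<Omega>t_12: "\<Omega>t$1 = \<Omega>0$1" "\<Omega>t$2 = \<Omega>0$2"
    by (simp_all add: assms(7))
  have "(\<Omega>0$1 = 0 \<and> \<Omega>0$2 = 0) \<or> A * \<Omega>t$3 = C * \<Omega>0$3" if "locally_central U R0"
  proof -
    have "G0 = vector [A * \<Omega>0$1, A * \<Omega>0$2, C * \<Omega>0$3]"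
      using inertia_mult_angular_velocity[of A C G0] assms(1,2,6) by (simp add: inertia_mult_vec)
    moreover have "cross3 G0 \<Omega>t = 0"
      using eqs(3) that by (simp add: locally_central_iff_cross3)
    \<comment> \<open>The first two components of the cross product; both share the factor
      \<open>A * \<Omega>t$3 - C * \<Omega>0$3\<close>, multiplied by \<open>\<Omega>0$2\<close> and
      \<open>\<Omega>0$1\<close> respectively up to sign. The third is trivial because A occurs
      twice in the inertia matrix.\<close>
    ultimately have "A * \<Omega>0$2 * \<Omega>t$3 = C * \<Omega>0$3 * \<Omega>0$2" "C * \<Omega>0$3 * \<Omega>0$1 = A * \<Omega>0$1 * \<Omega>t$3"
      by (simp_all add: cross3_def vec_eq_iff forall_3 \<Omega>t_12)
    then show ?thesis
      by auto
  qed
  \<comment> \<open>The third component of a cross product involves only the first two components of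
    \<open>\<Omega>t\<close>, which the shift by N leaves unchanged.\<close>
  moreover have P0_3: "P0$3 = R0$2 * \<Omega>0$1 - R0$1 * \<Omega>0$2"
    by (simp add: eqs(1) cross3_def \<Omega>t_12 algebra_simps)
  moreover have "P0$3 = 0" if "\<not> locally_central U R0"
  proof -
    have "R0 \<in> D"
      using assms(4) by (simp add: relative_equilibrium_def)
    then have "cross3 R0 (grad U R0) $ 3 = 0"
      using assms(3) by (simp add: axially_symmetric_potential_def cross3_def)
    with torque that central_iff show ?thesis
      by simp
  qed
  ultimately show ?thesis
    using central_iff locally_central_iff_cross3 by simp
qed

end
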